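(* Let $(S_7,\cdot)$ be the three-element commutative monoid $\{0,a,1\}$ with identity $1$, zero $0$ and $a\cdot a=0$. The ai-semiring $\mathcal{P}^+(S_7,\cdot)$ is nonfinitely based, i.e. there is no finite set of identities that defines the variety $\mathsf{V}(\mathcal{P}^+(S_7,\cdot))$ of ai-semirings.
   Context: An ai-semiring is an algebra $(S,+,\cdot)$ with $(S,+)$ a commutative idempotent semigroup, $(S,\cdot)$ a semigroup, and multiplication distributing over addition on both sides. No constants are in the signature. For a semigroup $S$, $\mathcal{P}^+(S)$ is the ai-semiring of all nonempty subsets of $S$ with $A+B=A\cup B$ and $AB=\{ab\mid a\in A,b\in B\}$. $\mathsf{V}(A)$ is the variety generated by $A$. *)

theory Defs
  imports Main "HOL-Library.FuncSet"
begin

section \<open>Ai-semirings\<close>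

record 'a ai_alg =
  carrier :: "'a set"
  add :: "'a \<Rightarrow> 'a \<Rightarrow> 'a" (infixl "\<oplus>\<index>" 65)
  mult :: "'a \<Rightarrow> 'a \<Rightarrow> 'a" (infixl "\<otimes>\<index>" 70)

text \<open>
  As usual in universal algebra, carriers are nonempty. There are no constants in the signature,
  and multiplication need not be commutative.
\<close>

locale ai_semiring =
  fixes S :: "'a ai_alg" (structure)
  assumes nonempty: "carrier S \<noteq> {}"
    and add_closed: "\<lbrakk>x \<in> carrier S; y \<in> carrier S\<rbrakk> \<Longrightarrow> x \<oplus> y \<in> carrier S"
    and add_assoc: "\<lbrakk>x \<in> carrier S; y \<in> carrier S; z \<in> carrier S\<rbrakk>
      \<Longrightarrow> (x \<oplus> y) \<oplus> z = x \<oplus> (y \<oplus> z)"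
    and add_comm: "\<lbrakk>x \<in> carrier S; y \<in> carrier S\<rbrakk> \<Longrightarrow> x \<oplus> y = y \<oplus> x"
    and add_idem: "x \<in> carrier S \<Longrightarrow> x \<oplus> x = x"
    and mult_closed: "\<lbrakk>x \<in> carrier S; y \<in> carrier S\<rbrakk> \<Longrightarrow> x \<otimes> y \<in> carrier S"
    and mult_assoc: "\<lbrakk>x \<in> carrier S; y \<in> carrier S; z \<in> carrier S\<rbrakk>
      \<Longrightarrow> (x \<otimes> y) \<otimes> z = x \<otimes> (y \<otimes> z)"
    and distrib_left: "\<lbrakk>x \<in> carrier S; y \<in> carrier S; z \<in> carrier S\<rbrakk>
      \<Longrightarrow> x \<otimes> (y \<oplus> z) = (x \<otimes> y) \<oplus> (x \<otimes> z)"
    and distrib_right: "\<lbrakk>x \<in> carrier S; y \<in> carrier S; z \<in> carrier S\<rbrakk>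
      \<Longrightarrow> (x \<oplus> y) \<otimes> z = (x \<otimes> z) \<oplus> (y \<otimes> z)"

definition subuniverse :: "'a set \<Rightarrow> 'a ai_alg \<Rightarrow> bool" where
  "subuniverse C S \<longleftrightarrow> C \<noteq> {} \<and> C \<subseteq> carrier S \<and>
     (\<forall>x\<in>C. \<forall>y\<in>C. x \<oplus>\<^bsub>S\<^esub> y \<in> C \<and> x \<otimes>\<^bsub>S\<^esub> y \<in> C)"

definition ai_hom_on :: "'a set \<Rightarrow> 'a ai_alg \<Rightarrow> 'b ai_alg \<Rightarrow> ('a \<Rightarrow> 'b) \<Rightarrow> bool" where
  "ai_hom_on C S T h \<longleftrightarrow> h ` C \<subseteq> carrier T \<and>
     (\<forall>x\<in>C. \<forall>y\<in>C. h (x \<oplus>\<^bsub>S\<^esub> y) = h x \<oplus>\<^bsub>T\<^esub> h y \<and> h (x \<otimes>\<^bsub>S\<^esub> y) = h x \<otimes>\<^bsub>T\<^esub> h y)"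

definition direct_power :: "'i set \<Rightarrow> 'a ai_alg \<Rightarrow> ('i \<Rightarrow> 'a) ai_alg" where
  "direct_power I S =
     \<lparr>carrier = (\<Pi>\<^sub>E i\<in>I. carrier S),
      add = (\<lambda>f g. \<lambda>i\<in>I. f i \<oplus>\<^bsub>S\<^esub> g i),
      mult = (\<lambda>f g. \<lambda>i\<in>I. f i \<otimes>\<^bsub>S\<^esub> g i)\<rparr>"


section \<open>The variety generated by an algebra\<close>

text \<open>
  \<open>variety S\<close> consists of the members, with carrier inside the type \<open>'b\<close>, of the smallest class
  containing \<open>S\<close> and closed under homomorphic images, subalgebras and direct products, in the form
  \<open>HSP(S)\<close>: homomorphic images of subalgebras of direct powers of \<open>S\<close>. HOL cannot quantify over
  the type of the index set of the power; \<open>'b \<Rightarrow> 'a\<close> is large enough, as lemma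
  \<open>in_variety_any_index\<close> below shows that a power with an index set of any other type yields
  nothing new.
\<close>

definition variety :: "'a ai_alg \<Rightarrow> 'b ai_alg set" where
  "variety S = {T. \<exists>(I :: ('b \<Rightarrow> 'a) set) C h.
     subuniverse C (direct_power I S) \<and> ai_hom_on C (direct_power I S) T h \<and> h ` C = carrier T}"

lemma in_variety_any_index:
  fixes S :: "'a ai_alg" and T :: "'b ai_alg" and J :: "'j set"
  assumes C: "subuniverse C (direct_power J S)"
    and h: "ai_hom_on C (direct_power J S) T h"
    and surj: "h ` C = carrier T"
  shows "T \<in> variety S"
proof -
  have Csub: "C \<subseteq> (\<Pi>\<^sub>E j\<in>J. carrier S)" and Cne: "C \<noteq> {}"
    using C by (auto simp: subuniverse_def direct_power_def)
  obtain c0 where c0: "c0 \<in> C" using Cne by blast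
  define c where "c b = (if b \<in> carrier T then inv_into C h b else c0)" for b
  have cC: "c b \<in> C" for b
    using surj c0 by (auto simp: c_def intro: inv_into_into)
  have hc: "h (c b) = b" if "b \<in> carrier T" for b
    using that surj by (simp add: c_def f_inv_into_f)
  have cS: "c b j \<in> carrier S" if "j \<in> J" for b j
    using cC[of b] Csub that by auto
  define ix where "ix j = (\<lambda>b. c b j)" for j
  define I where "I = ix ` J"
  define pull where "pull g = (\<lambda>j\<in>J. g (ix j))" for g :: "('b \<Rightarrow> 'a) \<Rightarrow> 'a"
  define D where "D = {g \<in> carrier (direct_power I S). pull g \<in> C}"
  have pull_add: "pull (g \<oplus>\<^bsub>direct_power I S\<^esub> g') = pull g \<oplus>\<^bsub>direct_power J S\<^esub> pull g'" for g g'
    by (auto simp: direct_power_def pull_def I_def)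
  have pull_mult: "pull (g \<otimes>\<^bsub>direct_power I S\<^esub> g') = pull g \<otimes>\<^bsub>direct_power J S\<^esub> pull g'" for g g'
    by (auto simp: direct_power_def pull_def I_def)
  have clos: "g \<oplus>\<^bsub>direct_power I S\<^esub> g' \<in> D" "g \<otimes>\<^bsub>direct_power I S\<^esub> g' \<in> D"
    if "g \<in> D" "g' \<in> D" for g g'
  proof -
    have p: "pull g \<in> C" "pull g' \<in> C" using that by (auto simp: D_def)
    have a: "pull g \<oplus>\<^bsub>direct_power J S\<^esub> pull g' \<in> C" "pull g \<otimes>\<^bsub>direct_power J S\<^esub> pull g' \<in> C"
      using C p by (auto simp: subuniverse_def)
    have "g (ix j) \<oplus>\<^bsub>S\<^esub> g' (ix j) \<in> carrier S" "g (ix j) \<otimes>\<^bsub>S\<^esub> g' (ix j) \<in> carrier S"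
      if "j \<in> J" for j
    proof -
      have "(pull g \<oplus>\<^bsub>direct_power J S\<^esub> pull g') j \<in> carrier S"
        "(pull g \<otimes>\<^bsub>direct_power J S\<^esub> pull g') j \<in> carrier S"
        using a Csub that by auto
      then show "g (ix j) \<oplus>\<^bsub>S\<^esub> g' (ix j) \<in> carrier S" "g (ix j) \<otimes>\<^bsub>S\<^esub> g' (ix j) \<in> carrier S"
        using that by (auto simp: direct_power_def pull_def)
    qed
    then have "g \<oplus>\<^bsub>direct_power I S\<^esub> g' \<in> carrier (direct_power I S)"
      "g \<otimes>\<^bsub>direct_power I S\<^esub> g' \<in> carrier (direct_power I S)"
      by (auto simp: direct_power_def I_def)
    with a show "g \<oplus>\<^bsub>direct_power I S\<^esub> g' \<in> D" "g \<otimes>\<^bsub>direct_power I S\<^esub> g' \<in> D"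
      by (auto simp: D_def pull_add pull_mult)
  qed
  define p where "p b = (\<lambda>i\<in>I. i b)" for b
  have pull_p: "pull (p b) = c b" for b
  proof -
    have "pull (p b) = restrict (c b) J"
      by (auto simp: pull_def p_def ix_def I_def)
    also have "\<dots> = c b"
      using cC[of b] Csub by (meson PiE_restrict subsetD)
    finally show ?thesis .
  qed
  have pD: "p b \<in> D" for b
  proof -
    have "p b \<in> carrier (direct_power I S)"
      by (auto simp: direct_power_def p_def I_def ix_def cS)
    then show ?thesis by (simp add: D_def pull_p cC)
  qed
  have "subuniverse D (direct_power I S)"
    using pD clos by (auto simp: subuniverse_def D_def)
  moreover have "ai_hom_on D (direct_power I S) T (h \<circ> pull)"
    using h by (auto simp: ai_hom_on_def D_def pull_add pull_mult)
  moreover have "(h \<circ> pull) ` D = carrier T"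
  proof
    show "(h \<circ> pull) ` D \<subseteq> carrier T" using surj by (auto simp: D_def)
    show "carrier T \<subseteq> (h \<circ> pull) ` D"
    proof
      fix b assume "b \<in> carrier T"
      then have "(h \<circ> pull) (p b) = b" by (simp add: pull_p hc)
      then show "b \<in> (h \<circ> pull) ` D" using pD[of b] by (metis imageI)
    qed
  qed
  ultimately show ?thesis unfolding variety_def by blast
qed


section \<open>Identities\<close>

datatype ai_term = Var nat | Add ai_term ai_term | Mult ai_term ai_term

type_synonym identity = "ai_term \<times> ai_term"

primrec ai_eval :: "'a ai_alg \<Rightarrow> (nat \<Rightarrow> 'a) \<Rightarrow> ai_term \<Rightarrow> 'a" where
  "ai_eval S v (Var n) = v n"
| "ai_eval S v (Add s t) = ai_eval S v s \<oplus>\<^bsub>S\<^esub> ai_eval S v t"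
| "ai_eval S v (Mult s t) = ai_eval S v s \<otimes>\<^bsub>S\<^esub> ai_eval S v t"

definition satisfies :: "'a ai_alg \<Rightarrow> identity \<Rightarrow> bool" where
  "satisfies S e \<longleftrightarrow>
     (\<forall>v. (\<forall>n. v n \<in> carrier S) \<longrightarrow> ai_eval S v (fst e) = ai_eval S v (snd e))"

text \<open>
  \<open>ai_models E\<close> is the class of ai-semirings, with carrier inside the type \<open>'b\<close>, defined by the
  identities \<open>E\<close>. A set of identities that defines the variety generated by \<open>S\<close> outright would
  satisfy \<open>defines_variety TYPE('b) E S\<close> for every type \<open>'b\<close>; for an infinite \<open>'b\<close>, which has room
  for all countable algebras, satisfying it is no weaker.
\<close>

definition ai_models :: "identity set \<Rightarrow> 'b ai_alg set" where
  "ai_models E = {T. ai_semiring T \<and> (\<forall>e\<in>E. satisfies T e)}"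

definition defines_variety :: "'b itself \<Rightarrow> identity set \<Rightarrow> 'a ai_alg \<Rightarrow> bool" where
  "defines_variety _ E S \<longleftrightarrow> (ai_models E :: 'b ai_alg set) = variety S"

definition finitely_based :: "'b itself \<Rightarrow> 'a ai_alg \<Rightarrow> bool" where
  "finitely_based TYPE('b) S \<longleftrightarrow> (\<exists>E. finite E \<and> defines_variety TYPE('b) E S)"


section \<open>Power ai-semirings and the monoid \<open>S\<^sub>7\<close>\<close>

definition power_ai :: "'a::semigroup_mult set ai_alg" where
  "power_ai = \<lparr>carrier = {A. A \<noteq> {}}, add = (\<union>), mult = (\<lambda>A B. {a * b | a b. a \<in> A \<and> b \<in> B})\<rparr>"

lemma ai_semiring_power_ai: "ai_semiring (power_ai :: 'a::semigroup_mult set ai_alg)"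
proof (unfold_locales, goal_cases)
  case (7 x y z)
  show ?case
    by (simp add: power_ai_def) (metis (no_types, opaque_lifting) mult.assoc)
qed (auto simp: power_ai_def)

datatype s7 = S7_zero | S7_a | S7_one

instantiation s7 :: "{comm_monoid_mult, mult_zero}"
begin

definition zero_s7 :: s7 where "0 = S7_zero"

definition one_s7 :: s7 where "1 = S7_one"

fun times_s7 :: "s7 \<Rightarrow> s7 \<Rightarrow> s7" where
  "times_s7 S7_one y = y"
| "times_s7 x S7_one = x"
| "times_s7 _ _ = S7_zero"

instance
proof
  fix x y z :: s7
  show "x * y * z = x * (y * z)" by (cases x; cases y; cases z) simp_all
  show "x * y = y * x" by (cases x; cases y) simp_all
  show "1 * x = x" by (simp add: one_s7_def)
  show "0 * x = 0" "x * 0 = 0" by (cases x; simp add: zero_s7_def)+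
qed

end

end

(*
Take an affine plane of prime order p with one variable for each point. Any two points lie on a
line, so whatever values in S7 the points take, their product over the whole plane equals the
product over some line. Since the words involved are linear, the power semiring therefore
satisfies "sum of all lines = sum of all lines + product of all points".

On the other hand, identify two commutative words in the points when they have the same contexts,
i.e. are completed to lines by the same words. The classes form a finite ai-semiring in which the
sum of two distinct classes is the class without contexts; it violates the identity above but
satisfies every identity s = t of the power semiring in fewer than p - 1 variables. For suppose
that substituting words for variables turns every word of s into a line. Being few, the variables
leave on every line m a point f(m) that is not substituted for a variable by itself. For each
point x, let A(x) be the set of variables whose substituted word contains x, or contains f(m) for
a line m that misses x and contains that word. A word with at least two points lies on at most
one line, so every word of s has exactly one occurrence of a variable in A(x). The power semiring
transfers this property to the words of t, and having it for all x forces them to become lines.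
*)

theory Submission
  imports Defs "HOL-Library.Multiset" "HOL-Library.Countable" "HOL-Number_Theory.Cong"
begin

section \<open>Identities as sets of commutative words\<close>

text \<open>The value of a term in the free commutative ai-semiring, whose elements are the finite
  nonempty sets of nonempty commutative words. Words are multisets because S7 is
  commutative.\<close>

primrec term_words :: "ai_term \<Rightarrow> nat multiset set" where
  "term_words (Var n) = {{#n#}}"
| "term_words (Add s t) = term_words s \<union> term_words t"
| "term_words (Mult s t) = {u + v | u v. u \<in> term_words s \<and> v \<in> term_words t}"

primrec term_vars :: "ai_term \<Rightarrow> nat set" where
  "term_vars (Var n) = {n}"
| "term_vars (Add s t) = term_vars s \<union> term_vars t"
| "term_vars (Mult s t) = term_vars s \<union> term_vars t"

lemma finite_term_vars: "finite (term_vars t)"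
  by (induction t) auto

lemma term_words_vars: "u \<in> term_words t \<Longrightarrow> set_mset u \<subseteq> term_vars t"
proof (induction t arbitrary: u)
  case (Mult s t)
  then obtain u1 u2 where "u = u1 + u2" "u1 \<in> term_words s" "u2 \<in> term_words t" by auto
  with Mult.IH show ?case by auto
qed auto

lemma term_of_word: "u \<noteq> {#} \<Longrightarrow> \<exists>t. term_words t = {u}"
proof (induction u)
  case (add x u)
  show ?case
  proof (cases "u = {#}")
    case True
    then show ?thesis by (intro exI[of _ "Var x"]) simp
  next
    case False
    then obtain t where "term_words t = {u}" using add.IH by blast
    then show ?thesis by (intro exI[of _ "Mult (Var x) t"]) simp
  qed
qed simp

text \<open>Turns the sets of words of the plane identity into terms. The signature has no
  constants, which rules out the empty set and the empty word.\<close>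

lemma term_of_words:
  assumes "finite U" "U \<noteq> {}" "{#} \<notin> U"
  shows "\<exists>t. term_words t = U"
  using assms
proof (induction U rule: finite_ne_induct)
  case (singleton u)
  then show ?case using term_of_word[of u] by auto
next
  case (insert u U)
  then obtain s t where "term_words s = {u}" "term_words t = U"
    using term_of_word[of u] by auto
  then show ?case by (intro exI[of _ "Add s t"]) simp
qed

text \<open>Singletons multiply like their elements and addition collects them, so such assignments
  read off the value of each word separately.\<close>

lemma eval_power_singleton:
  "ai_eval power_ai (\<lambda>n. {\<alpha> n}) t = (\<lambda>u. \<Prod>y\<in>#u. \<alpha> y) ` term_words t"
  for \<alpha> :: "nat \<Rightarrow> 'a::comm_monoid_mult"
proof (induction t)
  case (Mult s t)
  have "ai_eval power_ai (\<lambda>n. {\<alpha> n}) (Mult s t)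
      = {a * b | a b. a \<in> ai_eval power_ai (\<lambda>n. {\<alpha> n}) s \<and> b \<in> ai_eval power_ai (\<lambda>n. {\<alpha> n}) t}"
    by (simp add: power_ai_def)
  also have "\<dots> = (\<lambda>u. \<Prod>y\<in>#u. \<alpha> y) ` term_words (Mult s t)"
    unfolding Mult.IH by (force simp flip: prod_mset.union image_mset_union)
  finally show ?case .
qed (auto simp: power_ai_def)

text \<open>A product of sets contains the product in which all occurrences of a variable use the
  same element, whether or not the word is linear.\<close>

lemma eval_power_choice:
  fixes \<alpha> :: "nat \<Rightarrow> 'a::comm_monoid_mult"
  assumes "\<And>n. \<alpha> n \<in> v n" "u \<in> term_words t"
  shows "(\<Prod>y\<in>#u. \<alpha> y) \<in> ai_eval power_ai v t"
  using assms(2)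
proof (induction t arbitrary: u)
  case (Var n)
  then show ?case using assms(1) by simp
next
  case (Add s t)
  then show ?case by (auto simp: power_ai_def)
next
  case (Mult s t)
  then obtain u1 u2 where "u = u1 + u2" "u1 \<in> term_words s" "u2 \<in> term_words t" by auto
  with Mult.IH show ?case by (auto simp: power_ai_def)
qed

text \<open>The conclusion fails for nonlinear words: in \<open>x x\<close> the two occurrences may take different values in \<open>v x\<close>.\<close>

lemma eval_power_linear:
  fixes v :: "nat \<Rightarrow> 'a::comm_monoid_mult set"
  assumes ne: "\<And>n. v n \<noteq> {}"
  shows "z \<in> ai_eval power_ai v t \<Longrightarrow>
    \<exists>u\<in>term_words t. (\<forall>x. count u x \<le> 1) \<longrightarrow>
      (\<exists>\<alpha>. (\<forall>n. \<alpha> n \<in> v n) \<and> z = (\<Prod>y\<in>#u. \<alpha> y))"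
proof (induction t arbitrary: z)
  case (Var n)
  obtain \<alpha> where "\<forall>n. \<alpha> n \<in> v n" using ne by (meson all_not_in_conv)
  with Var show ?case by (auto intro!: exI[of _ "\<alpha>(n := z)"])
next
  case (Add s t)
  then consider "z \<in> ai_eval power_ai v s" | "z \<in> ai_eval power_ai v t"
    by (auto simp: power_ai_def)
  then show ?case using Add.IH by cases (simp, blast)+
next
  case (Mult s t)
  then obtain z1 z2 where z: "z = z1 * z2" "z1 \<in> ai_eval power_ai v s" "z2 \<in> ai_eval power_ai v t"
    by (auto simp: power_ai_def)
  obtain u1 where u1: "u1 \<in> term_words s" "(\<forall>x. count u1 x \<le> 1) \<longrightarrow>
      (\<exists>\<alpha>. (\<forall>n. \<alpha> n \<in> v n) \<and> z1 = (\<Prod>y\<in>#u1. \<alpha> y))" using Mult.IH(1)[OF z(2)] by blast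
  obtain u2 where u2: "u2 \<in> term_words t" "(\<forall>x. count u2 x \<le> 1) \<longrightarrow>
      (\<exists>\<alpha>. (\<forall>n. \<alpha> n \<in> v n) \<and> z2 = (\<Prod>y\<in>#u2. \<alpha> y))" using Mult.IH(2)[OF z(3)] by blast
  show ?case
  proof (intro bexI[of _ "u1 + u2"] impI)
    show "u1 + u2 \<in> term_words (Mult s t)" using u1 u2 by auto
    assume lin: "\<forall>x. count (u1 + u2) x \<le> 1"
    have "count u1 x \<le> 1" "count u2 x \<le> 1" for x
      using lin[rule_format, of x] by auto
    then obtain \<alpha> \<beta> where \<alpha>: "\<forall>n. \<alpha> n \<in> v n" "z1 = (\<Prod>y\<in>#u1. \<alpha> y)"
      and \<beta>: "\<forall>n. \<beta> n \<in> v n" "z2 = (\<Prod>y\<in>#u2. \<beta> y)" using u1 u2 by blast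
    \<comment> \<open>By linearity \<open>u1\<close> and \<open>u2\<close> share no variable, so the
      two choices can be glued.\<close>
    define \<gamma> where "\<gamma> n = (if n \<in># u1 then \<alpha> n else \<beta> n)" for n
    have disj: "x \<notin># u1" if "x \<in># u2" for x
      using lin[rule_format, of x] that by (auto simp: not_in_iff count_greater_zero_iff[symmetric] simp del: count_greater_zero_iff)
    have "image_mset \<gamma> u1 = image_mset \<alpha> u1" "image_mset \<gamma> u2 = image_mset \<beta> u2"
      by (auto simp: \<gamma>_def disj intro!: image_mset_cong)
    then show "\<exists>\<alpha>. (\<forall>n. \<alpha> n \<in> v n) \<and> z = (\<Prod>y\<in>#u1 + u2. \<alpha> y)"
      using \<alpha> \<beta> z(1) by (intro exI[of _ \<gamma>]) (simp, simp add: \<gamma>_def)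
  qed
qed


section \<open>Satisfaction in the generated variety\<close>

lemma eval_direct_power:
  assumes "i \<in> I"
  shows "ai_eval (direct_power I S) v t i = ai_eval S (\<lambda>n. v n i) t"
  using assms by (induction t) (auto simp: direct_power_def)

lemma eval_subuniverse:
  assumes "subuniverse C S" "\<And>n. v n \<in> C"
  shows "ai_eval S v t \<in> C"
  using assms by (induction t) (auto simp: subuniverse_def)

lemma eval_hom:
  assumes "subuniverse C S" "ai_hom_on C S T h" "\<And>n. v n \<in> C"
  shows "h (ai_eval S v t) = ai_eval T (\<lambda>n. h (v n)) t"
  using assms by (induction t) (auto simp: ai_hom_on_def eval_subuniverse)

text \<open>The easy half of Birkhoff's theorem: identities pass to powers, subalgebras and
  homomorphic images.\<close>

lemma variety_satisfies:
  fixes S :: "'a ai_alg" and T :: "'b ai_alg"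
  assumes T: "T \<in> variety S" and S: "satisfies S e"
  shows "satisfies T e"
  unfolding satisfies_def
proof (intro allI impI)
  fix v :: "nat \<Rightarrow> 'b" assume v: "\<forall>n. v n \<in> carrier T"
  obtain I :: "('b \<Rightarrow> 'a) set" and C h where C: "subuniverse C (direct_power I S)"
    and h: "ai_hom_on C (direct_power I S) T h" "h ` C = carrier T"
    using T unfolding variety_def by blast
  define w where "w n = inv_into C h (v n)" for n
  have w: "w n \<in> C" "h (w n) = v n" for n
    using v h(2) by (auto simp: w_def inv_into_into f_inv_into_f)
  have PiE: "C \<subseteq> (\<Pi>\<^sub>E i\<in>I. carrier S)"
    using C by (auto simp: subuniverse_def direct_power_def)
  have "ai_eval (direct_power I S) w (fst e) = ai_eval (direct_power I S) w (snd e)"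
  proof (rule PiE_ext)
    show "ai_eval (direct_power I S) w (fst e) \<in> (\<Pi>\<^sub>E i\<in>I. carrier S)"
      "ai_eval (direct_power I S) w (snd e) \<in> (\<Pi>\<^sub>E i\<in>I. carrier S)"
      using eval_subuniverse[OF C] w PiE by blast+
    fix i assume i: "i \<in> I"
    then have "w n i \<in> carrier S" for n using w(1)[of n] PiE by auto
    then show "ai_eval (direct_power I S) w (fst e) i = ai_eval (direct_power I S) w (snd e) i"
      using S by (simp add: eval_direct_power i satisfies_def)
  qed
  then have "h (ai_eval (direct_power I S) w (fst e)) = h (ai_eval (direct_power I S) w (snd e))"
    by simp
  then show "ai_eval T v (fst e) = ai_eval T v (snd e)"
    using w by (simp add: eval_hom[OF C h(1)])
qed

lemma eval_closed:
  assumes "ai_semiring S" "\<And>n. v n \<in> carrier S"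
  shows "ai_eval S v t \<in> carrier S"
  using assms by (induction t) (auto simp: ai_semiring.add_closed ai_semiring.mult_closed)


text \<open>\<open>defines_variety\<close> sees only algebras with carrier inside \<open>'b\<close>.
  A finite algebra fits into any infinite type, and its copy there stands for it in the final
  argument.\<close>

lemma infinite_type_copy:
  fixes S :: "'a ai_alg"
  assumes S: "ai_semiring S" and fin: "finite (carrier S)" and inf: "infinite (UNIV :: 'b set)"
  obtains T :: "'b ai_alg" where "ai_semiring T" "T \<in> variety S"
    "\<And>e. satisfies T e \<longleftrightarrow> satisfies S e"
proof -
  obtain B :: "'b set" where "finite B" "card B = card (carrier S)"
    using infinite_arbitrarily_large[OF inf] by blast
  then obtain g where "bij_betw g (carrier S) B"
    using fin finite_same_card_bij by metis
  then have g: "inj_on g (carrier S)" by (rule bij_betw_imp_inj_on)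
  define g' where "g' = inv_into (carrier S) g"
  have g'g: "g' (g x) = x" if "x \<in> carrier S" for x
    using g that by (simp add: g'_def)
  define T where "T = \<lparr>carrier = g ` carrier S, add = (\<lambda>x y. g (g' x \<oplus>\<^bsub>S\<^esub> g' y)),
    mult = (\<lambda>x y. g (g' x \<otimes>\<^bsub>S\<^esub> g' y))\<rparr>"
  \<comment> \<open>The power over a one-point index set is isomorphic to \<open>S\<close>, which
    exhibits \<open>T\<close> as a member of the variety.\<close>
  let ?P = "direct_power {()} S"
  interpret S: ai_semiring S by (fact S)
  note clos = S.add_closed S.mult_closed
  have carP: "carrier ?P = {f. f () \<in> carrier S}"
    by (auto simp: direct_power_def PiE_def extensional_def)
  have const: "(\<lambda>_. x) \<in> carrier ?P" if "x \<in> carrier S" for x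
    using that by (simp add: carP)
  have sub: "subuniverse (carrier ?P) ?P"
    unfolding subuniverse_def
  proof (intro conjI ballI)
    show "carrier ?P \<noteq> {}" using S.nonempty const by blast
  qed (auto simp: carP clos, auto simp: direct_power_def clos)
  have hom: "ai_hom_on (carrier ?P) ?P T (\<lambda>f. g (f ()))"
    unfolding ai_hom_on_def carP by (auto simp: T_def g'g direct_power_def)
  have surj: "(\<lambda>f. g (f ())) ` carrier ?P = carrier T"
  proof
    show "carrier T \<subseteq> (\<lambda>f. g (f ())) ` carrier ?P"
      using const by (fastforce simp: T_def)
  qed (auto simp: carP T_def)
  have var: "T \<in> variety S"
    by (rule in_variety_any_index[OF sub hom surj])
  have T: "ai_semiring T"
  proof (unfold_locales, goal_cases)
    case (4 x y)
    then obtain a b where "a \<in> carrier S" "b \<in> carrier S" "x = g a" "y = g b"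
      by (auto simp: T_def)
    then show ?case using S.add_comm[of a b] by (simp add: T_def g'g)
  qed (auto simp: T_def g'g clos S.nonempty S.add_assoc S.add_idem S.mult_assoc S.distrib_left
        S.distrib_right)
  have sub': "subuniverse (carrier S) S" using S.nonempty clos by (simp add: subuniverse_def)
  have hom': "ai_hom_on (carrier S) S T g" by (auto simp: ai_hom_on_def T_def g'g)
  have "satisfies S e" if e: "satisfies T e" for e
    unfolding satisfies_def
  proof (intro allI impI)
    fix v :: "nat \<Rightarrow> 'a" assume v: "\<forall>n. v n \<in> carrier S"
    have "g (v n) \<in> carrier T" for n using v by (simp add: T_def)
    then have "ai_eval T (\<lambda>n. g (v n)) (fst e) = ai_eval T (\<lambda>n. g (v n)) (snd e)"
      using e unfolding satisfies_def by simp
    then have "g (ai_eval S v (fst e)) = g (ai_eval S v (snd e))"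
      using v by (simp only: eval_hom[OF sub' hom'])
    then show "ai_eval S v (fst e) = ai_eval S v (snd e)"
      by (rule inj_onD[OF g]) (use v S in \<open>simp_all add: eval_closed\<close>)
  qed
  then show ?thesis using variety_satisfies[OF var] by (intro that[OF T var] iffI)
qed


section \<open>Affine planes\<close>

text \<open>The plane as a design with \<open>p * p\<close> points; the parallel axiom follows from
  these by counting. The bound on \<open>p\<close> makes one of two complementary parts of a line
  have at least two points.\<close>

locale affine_plane =
  fixes P :: "'a set" and L :: "'a set set" and p :: nat
  assumes order: "3 \<le> p"
    and card_points: "card P = p * p"
    and line_subset: "l \<in> L \<Longrightarrow> l \<subseteq> P"
    and card_line: "l \<in> L \<Longrightarrow> card l = p"
    and line_through: "x \<in> P \<Longrightarrow> y \<in> P \<Longrightarrow> \<exists>l\<in>L. x \<in> l \<and> y \<in> l"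
    and line_unique: "l \<in> L \<Longrightarrow> l' \<in> L \<Longrightarrow> {x, y} \<subseteq> l \<Longrightarrow> {x, y} \<subseteq> l' \<Longrightarrow> x \<noteq> y \<Longrightarrow> l = l'"

text \<open>Variables of terms are natural numbers, so the coordinate plane has to be moved to
  them.\<close>

lemma affine_plane_image:
  assumes "affine_plane P L p" and g: "inj g"
  shows "affine_plane (g ` P) ((`) g ` L) p"
proof -
  interpret affine_plane P L p by fact
  show ?thesis
  proof
    show "card (g ` P) = p * p"
      using card_points card_image[OF inj_on_subset[OF g]] by simp
    show "\<exists>l\<in>(`) g ` L. x \<in> l \<and> y \<in> l" if pts: "x \<in> g ` P" "y \<in> g ` P" for x y
    proof -
      obtain x' y' where xy: "x' \<in> P" "y' \<in> P" "x = g x'" "y = g y'" using pts by blast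
      then obtain m where "m \<in> L" "x' \<in> m" "y' \<in> m" using line_through by blast
      with xy show ?thesis by (intro bexI[of _ "g ` m"]) auto
    qed
    show "l \<subseteq> g ` P" "card l = p" if "l \<in> (`) g ` L" for l
      using that line_subset card_line card_image[OF inj_on_subset[OF g]] by auto
    show "l = l'" if hyps: "l \<in> (`) g ` L" "l' \<in> (`) g ` L" "{x, y} \<subseteq> l" "{x, y} \<subseteq> l'" "x \<noteq> y" for l l' x y
    proof -
      obtain m m' where m: "m \<in> L" "m' \<in> L" "l = g ` m" "l' = g ` m'" using hyps by auto
      obtain x' y' where "x = g x'" "y = g y'" "{x', y'} \<subseteq> m" using hyps m by auto
      moreover from this have "{x', y'} \<subseteq> m'" using hyps m g by (auto simp: inj_image_mem_iff)
      ultimately show ?thesis using line_unique[of m m' x' y'] m hyps by auto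
    qed
  qed (rule order)
qed

text \<open>The coordinate plane over the integers modulo \<open>p\<close>, with vertical lines and
  lines given by slope and intercept. Lying on a line is treated as divisibility by
  \<open>q\<close>, so that equations can be combined linearly.\<close>

lemma affine_plane_exists:
  assumes "prime p" "3 \<le> p"
  shows "\<exists>P L. affine_plane (P :: (int \<times> int) set) L p"
proof -
  define q where "q = int p"
  have q: "prime q" "0 < q" using assms by (auto simp: q_def)
  define P where "P = {0..<q} \<times> {0..<q}"
  define vert where "vert i = {i::int} \<times> {0..<q}" for i
  define slant where "slant m b = (\<lambda>i. (i, (m * i + b) mod q)) ` {0..<q}" for m b
  define L where "L = vert ` {0..<q} \<union> (\<lambda>(m, b). slant m b) ` ({0..<q} \<times> {0..<q})"
  have eqmod: "a = b" if "a \<in> {0..<q}" "b \<in> {0..<q}" "q dvd a - b" for a b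
    using that by (simp add: mod_eq_dvd_iff[symmetric])
  have slantD: "snd x \<in> {0..<q} \<and> fst x \<in> {0..<q} \<and> q dvd m * fst x + b - snd x"
    if "x \<in> slant m b" for x m b
    using that q by (auto simp: slant_def dvd_minus_mod)
  have slantI: "x \<in> slant m b" if "x \<in> P" "q dvd m * fst x + b - snd x" for x m b
  proof -
    have "snd x = (m * fst x + b) mod q"
      using that by (cases x) (simp add: P_def mod_eq_dvd_iff[symmetric])
    with that show ?thesis by (cases x) (auto simp: slant_def P_def)
  qed
  have "affine_plane P L p"
  proof
    show "card P = p * p" by (simp add: P_def q_def card_cartesian_product)
    fix l assume "l \<in> L"
    then show "l \<subseteq> P" "card l = p"
      using q by (auto simp: L_def vert_def slant_def P_def card_cartesian_product card_image inj_on_def q_def)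
  next
    fix x y assume xy: "x \<in> P" "y \<in> P"
    obtain i j i' j' where ij: "x = (i, j)" "y = (i', j')" by (cases x, cases y)
    show "\<exists>l\<in>L. x \<in> l \<and> y \<in> l"
    proof (cases "i = i'")
      case True
      then show ?thesis using xy ij by (intro bexI[of _ "vert i"]) (auto simp: vert_def P_def L_def)
    next
      case False
      then have "\<not> q dvd i - i'" using eqmod xy ij by (auto simp: P_def)
      then have "coprime (i - i') q" using q prime_imp_coprime coprime_commute by blast
      \<comment> \<open>\<open>k\<close> inverts the difference of the first coordinates modulo
        \<open>q\<close>; it yields the slope through \<open>x\<close> and \<open>y\<close>.\<close>
      then obtain k where "[(i - i') * k = 1] (mod q)" using cong_solve_coprime_int by blast
      then have k: "q dvd (i - i') * k - 1" by (simp add: cong_iff_dvd_diff)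
      define m where "m = k * (j - j') mod q"
      define b where "b = (j - m * i) mod q"
      have km: "q dvd k * (j - j') - m" by (simp add: m_def)
      have "q dvd ((i - i') * k - 1) * (j - j') - (i - i') * (k * (j - j') - m)"
        by (rule dvd_diff[OF dvd_mult2[OF k] dvd_mult[OF km]])
      then have m: "q dvd (i - i') * m - (j - j')" by (simp add: algebra_simps)
      have "q dvd - ((j - m * i) - b)" unfolding dvd_minus_iff by (simp add: b_def)
      then have b: "q dvd m * i + b - j" by (simp add: algebra_simps)
      have "q dvd (m * i + b - j) - ((i - i') * m - (j - j'))" by (rule dvd_diff[OF b m])
      then have b': "q dvd m * i' + b - j'" by (simp add: algebra_simps)
      have "slant m b \<in> L" using q by (auto simp: L_def m_def b_def)
      moreover have "x \<in> slant m b" "y \<in> slant m b"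
        using b b' xy ij by (auto intro: slantI)
      ultimately show ?thesis by blast
    qed
  next
    fix l l' x y assume l: "l \<in> L" "l' \<in> L" "{x, y} \<subseteq> l" "{x, y} \<subseteq> l'" "x \<noteq> y"
    have mixed: False if "{x, y} \<subseteq> vert i" "{x, y} \<subseteq> slant m b" for i m b
      using that l by (auto simp: vert_def slant_def)
    have slants: "m = m' \<and> b = b'"
      if mb: "m \<in> {0..<q}" "b \<in> {0..<q}" "m' \<in> {0..<q}" "b' \<in> {0..<q}"
        and s: "{x, y} \<subseteq> slant m b" "{x, y} \<subseteq> slant m' b'" for m b m' b'
    proof -
      have x: "q dvd m * fst x + b - snd x" "q dvd m' * fst x + b' - snd x"
        and y: "q dvd m * fst y + b - snd y" "q dvd m' * fst y + b' - snd y"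
        and r: "fst x \<in> {0..<q}" "fst y \<in> {0..<q}"
        using s slantD by blast+
      have "fst x \<noteq> fst y" using l s by (auto simp: slant_def)
      then have nd: "\<not> q dvd fst x - fst y" using eqmod r by blast
      have 1: "q dvd (m * fst x + b - snd x) - (m' * fst x + b' - snd x)" using x by (rule dvd_diff)
      have 2: "q dvd (m * fst y + b - snd y) - (m' * fst y + b' - snd y)" using y by (rule dvd_diff)
      \<comment> \<open>Subtracting the equations at the two points eliminates the intercepts;
        primality of \<open>q\<close> then gives equal slopes.\<close>
      from dvd_diff[OF 1 2] have "q dvd (m - m') * (fst x - fst y)" by (simp add: algebra_simps)
      then have "q dvd m - m'" using nd q prime_dvd_mult_iff by blast
      then have "m = m'" using eqmod mb by blast
      with 1 have "q dvd b - b'" by simp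
      with \<open>m = m'\<close> show ?thesis using eqmod mb by blast
    qed
    have verts: "i = i'" if "{x, y} \<subseteq> vert i" "{x, y} \<subseteq> vert i'" for i i'
      using that by (auto simp: vert_def)
    have L_cases: "(\<exists>i. k = vert i) \<or> (\<exists>m\<in>{0..<q}. \<exists>b\<in>{0..<q}. k = slant m b)"
      if "k \<in> L" for k
      using that by (auto simp: L_def)
    consider i i' where "l = vert i" "l' = vert i'"
      | i m b where "l = vert i" "l' = slant m b"
      | i m b where "l = slant m b" "l' = vert i"
      | m b m' b' where "l = slant m b" "l' = slant m' b'"
        "m \<in> {0..<q}" "b \<in> {0..<q}" "m' \<in> {0..<q}" "b' \<in> {0..<q}"
      using L_cases[OF l(1)] L_cases[OF l(2)] by blast
    then show "l = l'"
    proof cases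
      case (1 i i')
      then show ?thesis using l(3,4) verts[of i i'] by simp
    next
      case (2 i m b)
      then show ?thesis using l(3,4) mixed[of i m b] by simp
    next
      case (3 i m b)
      then show ?thesis using l(3,4) mixed[of i m b] by simp
    next
      case (4 m b m' b')
      then show ?thesis using l(3,4) slants[of m b m' b'] by simp
    qed
  qed (rule assms(2))
  then show ?thesis by blast
qed

section \<open>Lines as linear words\<close>

lemma mset_set_set_mset: "mset_set (set_mset m) = m" if "\<And>x. count m x \<le> 1"
proof (rule multiset_eqI)
  fix x
  show "count (mset_set (set_mset m)) x = count m x"
  proof (cases "x \<in># m")
    case True
    then have "count m x = 1" using that by (meson count_greater_eq_one_iff le_antisym)
    then show ?thesis using True by simp
  qed (simp add: not_in_iff)
qed

context affine_plane
begin

lemma finite_points: "finite P"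
  using card_points order by (metis card.infinite mult_is_0 not_numeral_le_zero)

lemma finite_line: "l \<in> L \<Longrightarrow> finite l"
  using finite_points line_subset finite_subset by blast

definition line_words :: "'a multiset set" where
  "line_words = mset_set ` L"

lemma line_words_iff: "m \<in> line_words \<longleftrightarrow> set_mset m \<in> L \<and> (\<forall>x. count m x \<le> 1)"
proof
  assume "set_mset m \<in> L \<and> (\<forall>x. count m x \<le> 1)"
  then show "m \<in> line_words"
    using mset_set_set_mset by (metis imageI line_words_def)
qed (auto simp: line_words_def finite_line count_mset_set')

lemma size_line_word: "m \<in> line_words \<Longrightarrow> size m = p"
  by (auto simp: line_words_def card_line)

lemma finite_line_words: "finite line_words"
  using finite_points line_subset by (auto simp: line_words_def intro: finite_subset[of _ "Pow P"])

lemma subset_line_word_count: "m \<in> line_words \<Longrightarrow> u \<subseteq># m \<Longrightarrow> count u x \<le> 1"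
  using mset_subset_eq_count[of u m x] by (fastforce simp: line_words_iff dest: spec[of _ x])

text \<open>A subword of a line is linear, so size two already gives two distinct points, and these
  determine the line.\<close>

lemma line_word_unique:
  assumes m: "m \<in> line_words" "m' \<in> line_words" and u: "u \<subseteq># m" "u \<subseteq># m'" "2 \<le> size u"
  shows "m = m'"
proof -
  obtain x v where v: "u = add_mset x v" using u(3) by (cases u) auto
  have "v \<noteq> {#}" using u(3) v by auto
  then obtain y where y: "y \<in># v" by blast
  have "count u x \<le> 1" using subset_line_word_count m u by blast
  then have "x \<noteq> y" using v y by (auto simp flip: count_greater_zero_iff)
  moreover have "{x, y} \<subseteq> set_mset m" "{x, y} \<subseteq> set_mset m'"
    using v y u by (auto dest: mset_subset_eqD)
  ultimately have "set_mset m = set_mset m'"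
    using line_unique m by (auto simp: line_words_iff)
  then show ?thesis using m by (auto simp: line_words_def finite_line)
qed

end


section \<open>Identities of the power semiring\<close>

abbreviation subst_word :: "(nat \<Rightarrow> 'x multiset) \<Rightarrow> nat multiset \<Rightarrow> 'x multiset" where
  "subst_word w u \<equiv> (\<Sum>y\<in>#u. w y)"

text \<open>Since \<open>S7_a\<close> squares to zero, the product distinguishes no occurrence,
  exactly one, and more than one.\<close>

lemma prod_s7_indicator:
  "(\<Prod>y\<in>#u. if y \<in> A then S7_a else 1) =
    (if filter_mset (\<lambda>y. y \<in> A) u = {#} then 1
     else if size (filter_mset (\<lambda>y. y \<in> A) u) = 1 then S7_a else 0)"
  by (induction u) (auto simp: zero_s7_def one_s7_def)

text \<open>Put \<open>S7_a\<close> on \<open>A\<close> and 1 elsewhere: all words of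
  \<open>s\<close> take the value \<open>S7_a\<close>, hence so do all words of
  \<open>t\<close>.\<close>

lemma power_identity_one_occurrence:
  assumes "satisfies (power_ai :: s7 set ai_alg) (s, t)"
    and "\<And>\<sigma>. \<sigma> \<in> term_words s \<Longrightarrow> size (filter_mset (\<lambda>y. y \<in> A) \<sigma>) = 1"
    and "\<tau> \<in> term_words t"
  shows "size (filter_mset (\<lambda>y. y \<in> A) \<tau>) = 1"
proof -
  define \<alpha> where "\<alpha> y = (if y \<in> A then S7_a else 1)" for y
  have "ai_eval power_ai (\<lambda>n. {\<alpha> n}) s = ai_eval power_ai (\<lambda>n. {\<alpha> n}) t"
    using assms(1) by (simp add: satisfies_def power_ai_def)
  then have "(\<Prod>y\<in>#\<tau>. \<alpha> y) \<in> (\<lambda>u. \<Prod>y\<in>#u. \<alpha> y) ` term_words s"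
    using assms(3) by (auto simp: eval_power_singleton)
  then obtain \<sigma> where "\<sigma> \<in> term_words s" "(\<Prod>y\<in>#\<tau>. \<alpha> y) = (\<Prod>y\<in>#\<sigma>. \<alpha> y)" by auto
  then have "(\<Prod>y\<in>#\<tau>. \<alpha> y) = S7_a"
    using assms(2)[of \<sigma>]
    by (auto simp: \<alpha>_def prod_s7_indicator simp flip: filter_mset_eq_mempty_iff)
  then show ?thesis by (simp add: \<alpha>_def prod_s7_indicator one_s7_def zero_s7_def split: if_splits)
qed

lemma prod_s7_zero: "(\<Prod>y\<in>#u. if y = x then 0 else 1 :: s7) = (if x \<in># u then 0 else 1)"
  by (induction u) (auto simp: zero_s7_def one_s7_def)

text \<open>Put 0 on \<open>x\<close> and 1 elsewhere: the value 0 detects the words that contain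
  \<open>x\<close>.\<close>

lemma power_identity_letter:
  assumes "satisfies (power_ai :: s7 set ai_alg) (s, t)"
    and "\<tau> \<in> term_words t" "x \<in># \<tau>"
  obtains \<sigma> where "\<sigma> \<in> term_words s" "x \<in># \<sigma>"
proof -
  define \<alpha> where "\<alpha> y = (if y = x then 0 else 1 :: s7)" for y
  have "ai_eval power_ai (\<lambda>n. {\<alpha> n}) s = ai_eval power_ai (\<lambda>n. {\<alpha> n}) t"
    using assms(1) by (simp add: satisfies_def power_ai_def)
  then have "(\<Prod>y\<in>#\<tau>. \<alpha> y) \<in> (\<lambda>u. \<Prod>y\<in>#u. \<alpha> y) ` term_words s"
    using assms(2) by (auto simp: eval_power_singleton)
  then obtain \<sigma> where "\<sigma> \<in> term_words s" "(\<Prod>y\<in>#\<tau>. \<alpha> y) = (\<Prod>y\<in>#\<sigma>. \<alpha> y)" by auto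
  with that show ?thesis
    using assms(3) by (auto simp: \<alpha>_def prod_s7_zero zero_s7_def one_s7_def split: if_splits)
qed

lemma size_letters_containing:
  assumes "\<And>y. y \<in># u \<Longrightarrow> count (w y) x \<le> 1"
  shows "size (filter_mset (\<lambda>y. x \<in># w y) u) = count (subst_word w u) x"
  using assms
proof (induction u)
  case (add y u)
  have "count (w y) x \<le> 1" using add.prems by simp
  then have "count (w y) x = (if x \<in># w y then 1 else 0)"
    by (auto simp: not_in_iff Suc_le_eq simp flip: count_greater_zero_iff)
  with add show ?case by simp
qed simp

lemma subst_word_mono: "y \<in># u \<Longrightarrow> w y \<subseteq># subst_word w u"
  by (induction u) (auto intro: subset_mset.add_increasing subset_mset.add_increasing2)

section \<open>Transfer of lines along identities in few variables\<close>

context affine_plane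
begin

lemma line_words_transfer:
  assumes sat: "satisfies (power_ai :: s7 set ai_alg) (s, t)"
    and few: "card (term_vars s \<union> term_vars t) < p"
    and s: "\<And>\<sigma>. \<sigma> \<in> term_words s \<Longrightarrow> subst_word w \<sigma> \<in> line_words"
    and \<tau>: "\<tau> \<in> term_words t"
  shows "subst_word w \<tau> \<in> line_words"
proof -
  define V where "V = term_vars s \<union> term_vars t"
  have finV: "finite V" by (simp add: V_def finite_term_vars)
  have Vs: "y \<in> V" if "\<sigma> \<in> term_words s" "y \<in># \<sigma>" for \<sigma> y
    using term_words_vars that by (fastforce simp: V_def)
  have V\<tau>: "y \<in> V" if "y \<in># \<tau>" for y
    using term_words_vars that \<tau> by (fastforce simp: V_def)
  \<comment> \<open>Pigeonhole: a line has \<open>p\<close> points, but fewer than \<open>p\<close>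
    variables are available to be replaced by single points.\<close>
  have "\<exists>x\<in>#m. \<forall>y\<in>V. w y \<noteq> {#x#}" if m: "m \<in> line_words" for m
  proof (rule ccontr)
    assume "\<not> ?thesis"
    then have "\<forall>x\<in>#m. \<exists>y. y \<in> V \<and> w y = {#x#}" by blast
    then obtain g where g: "\<And>x. x \<in># m \<Longrightarrow> g x \<in> V \<and> w (g x) = {#x#}" by metis
    have "inj_on g (set_mset m)"
      by (rule inj_onI) (metis g single_eq_single)
    then have "card (set_mset m) \<le> card V"
      using g finV by (intro card_inj_on_le) auto
    moreover have "card (set_mset m) = p" using m card_line by (simp add: line_words_iff)
    ultimately show False using few by (simp add: V_def)
  qed
  then obtain f where f: "f m \<in># m" "y \<in> V \<Longrightarrow> w y \<noteq> {#f m#}" if "m \<in> line_words" for m y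
    by metis
  have big: "2 \<le> size (w y)" if hyps: "m \<in> line_words" "y \<in> V" "f m \<in># w y" for m y
  proof -
    obtain v where "w y = add_mset (f m) v" using multi_member_split[OF hyps(3)] by blast
    moreover have "v \<noteq> {#}" using f(2)[OF hyps(1,2)] calculation by auto
    ultimately show ?thesis by (cases v) auto
  qed
  define A where "A x = {y. x \<in># w y \<or>
    (\<exists>m\<in>line_words. w y \<subseteq># m \<and> x \<notin># m \<and> f m \<in># w y)}" for x
  have A_line: "y \<in> A x \<longleftrightarrow> (if x \<in># m then x else f m) \<in># w y"
    if m: "m \<in> line_words" "w y \<subseteq># m" and y: "y \<in> V" for x y m
  proof (cases "x \<in># w y")
    case True
    \<comment> \<open>Here \<open>x\<close> lies on \<open>m\<close>, because \<open>w y\<close>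
      does.\<close>
    then show ?thesis using m by (auto simp: A_def dest: mset_subset_eqD)
  next
    case False
    \<comment> \<open>A word containing the chosen point of a line above it has a second point, so
      no other line contains it.\<close>
    have uniq: "m' = m" if "m' \<in> line_words" "w y \<subseteq># m'" "f m' \<in># w y" for m'
      by (rule line_word_unique[OF that(1) m(1) that(2) m(2) big[OF that(1) y that(3)]])
    show ?thesis
    proof
      assume "y \<in> A x"
      then obtain m' where "m' \<in> line_words" "w y \<subseteq># m'" "x \<notin># m'" "f m' \<in># w y"
        using False by (auto simp: A_def)
      moreover from this have "m' = m" by (intro uniq)
      ultimately show "(if x \<in># m then x else f m) \<in># w y" by simp
    next
      assume "(if x \<in># m then x else f m) \<in># w y"
      then have "x \<notin># m" "f m \<in># w y" using False by (auto split: if_splits)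
      then show "y \<in> A x" using m by (auto simp: A_def)
    qed
  qed
  have count_le: "count (w y) x \<le> 1" if "m \<in> line_words" "w y \<subseteq># m" for m y x
    using subset_line_word_count that by blast
  have A_s: "size (filter_mset (\<lambda>y. y \<in> A x) \<sigma>) = 1" if \<sigma>: "\<sigma> \<in> term_words s" for \<sigma> x
  proof -
    define m where "m = subst_word w \<sigma>"
    define g where "g = (if x \<in># m then x else f m)"
    have m: "m \<in> line_words" using s[OF \<sigma>] by (simp add: m_def)
    have wm: "w y \<subseteq># m" if "y \<in># \<sigma>" for y using that by (simp add: m_def subst_word_mono)
    \<comment> \<open>All factors lie on the one line \<open>m\<close>, so membership in
      \<open>A x\<close> asks for the single point \<open>g\<close>, which occurs once in
      \<open>m\<close>.\<close>
    have "filter_mset (\<lambda>y. y \<in> A x) \<sigma> = filter_mset (\<lambda>y. g \<in># w y) \<sigma>"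
      using A_line[OF m wm Vs[OF \<sigma>]] by (intro filter_mset_cong) (auto simp: g_def)
    then have "size (filter_mset (\<lambda>y. y \<in> A x) \<sigma>) = count m g"
      using size_letters_containing[of \<sigma> w g] count_le[OF m wm] by (simp add: m_def)
    moreover have "g \<in># m" using f m by (simp add: g_def)
    then have "count m g = 1"
      using m by (meson count_greater_eq_one_iff le_antisym line_words_iff)
    ultimately show ?thesis by simp
  qed
  have A_\<tau>: "size (filter_mset (\<lambda>y. y \<in> A x) \<tau>) = 1" for x
    by (rule power_identity_one_occurrence[OF sat A_s \<tau>])
  have factor: "\<exists>m\<in>line_words. w y \<subseteq># m" if "y \<in># \<tau>" for y
    using power_identity_letter[OF sat \<tau> that] s subst_word_mono by metis
  \<comment> \<open>Otherwise \<open>A x\<close> would only ask for \<open>x\<close> itself on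
    \<open>\<tau>\<close>, and the factors of \<open>\<tau>\<close> would cover the plane. Fewer
    than \<open>p\<close> variables with at most \<open>p\<close> points each cannot cover
    \<open>p * p\<close> points.\<close>
  have "\<exists>y\<in>#\<tau>. \<exists>m\<in>line_words. w y \<subseteq># m \<and> f m \<in># w y"
  proof (rule ccontr)
    assume none: "\<not> ?thesis"
    have "P \<subseteq> (\<Union>y\<in>set_mset \<tau>. set_mset (w y))"
    proof
      fix x assume "x \<in> P"
      obtain y where "y \<in># filter_mset (\<lambda>y. y \<in> A x) \<tau>"
        using A_\<tau>[of x] by (metis multiset_nonemptyE size_empty zero_neq_one)
      then have "y \<in># \<tau>" "y \<in> A x" by auto
      then show "x \<in> (\<Union>y\<in>set_mset \<tau>. set_mset (w y))" using none by (auto simp: A_def)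
    qed
    then have "card P \<le> card (\<Union>y\<in>set_mset \<tau>. set_mset (w y))" by (intro card_mono) auto
    also have "\<dots> \<le> (\<Sum>y\<in>set_mset \<tau>. card (set_mset (w y)))" by (rule card_UN_le) simp
    also have "\<dots> \<le> (\<Sum>y\<in>set_mset \<tau>. p)"
    proof (rule sum_mono)
      fix y assume "y \<in> set_mset \<tau>"
      then obtain m where m: "m \<in> line_words" "w y \<subseteq># m" using factor by blast
      have "card (set_mset (w y)) \<le> card (set_mset m)"
        using m by (intro card_mono) (auto dest: mset_subset_eqD)
      then show "card (set_mset (w y)) \<le> p" using m card_line by (simp add: line_words_iff)
    qed
    also have "\<dots> \<le> card V * p"
      using card_mono[OF finV, of "set_mset \<tau>"] V\<tau> by auto
    also have "\<dots> < p * p" using few order by (simp add: V_def)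
    finally show False using card_points by simp
  qed
  then obtain y0 m where y0: "y0 \<in># \<tau>" "w y0 \<subseteq># m" "f m \<in># w y0" and m: "m \<in> line_words" by blast
  have inside: "x \<in># m" if "y \<in># \<tau>" "x \<in># w y" for x y
  proof (rule ccontr)
    assume x: "x \<notin># m"
    \<comment> \<open>For \<open>x\<close> off \<open>m\<close>, the variable \<open>y0\<close>
      already is the one occurrence in \<open>A x\<close>, through the point
      \<open>f m\<close>.\<close>
    have "y0 \<in># filter_mset (\<lambda>y. y \<in> A x) \<tau>" "y \<in># filter_mset (\<lambda>y. y \<in> A x) \<tau>"
      using x y0 m that by (auto simp: A_def)
    then have "y = y0"
      using A_\<tau>[of x] by (metis One_nat_def size_1_singleton_mset set_mset_single singletonD)
    then show False using x that y0 by (auto dest: mset_subset_eqD)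
  qed
  have wm: "w y \<subseteq># m" if "y \<in># \<tau>" for y
  proof (rule mset_subset_eqI)
    fix x
    obtain m' where "m' \<in> line_words" "w y \<subseteq># m'" using factor \<open>y \<in># \<tau>\<close> by blast
    then have "count (w y) x \<le> 1" by (rule count_le)
    moreover have "1 \<le> count m x" if "x \<in># w y"
      using inside[OF \<open>y \<in># \<tau>\<close> that] by simp
    ultimately show "count (w y) x \<le> count m x"
      by (cases "x \<in># w y") (blast intro: order_trans, simp add: not_in_iff)
  qed
  have "subst_word w \<tau> = m"
  proof (rule multiset_eqI)
    fix x
    have c: "size (filter_mset (\<lambda>y. x \<in># w y) \<tau>) = count (subst_word w \<tau>) x"
      by (rule size_letters_containing) (use count_le m wm in blast)
    show "count (subst_word w \<tau>) x = count m x"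
    proof (cases "x \<in># m")
      case True
      \<comment> \<open>With all factors on \<open>m\<close>, the one occurrence in
        \<open>A x\<close> contributes the one copy of \<open>x\<close>.\<close>
      have "filter_mset (\<lambda>y. x \<in># w y) \<tau> = filter_mset (\<lambda>y. y \<in> A x) \<tau>"
        using A_line[OF m wm V\<tau>] True by (intro filter_mset_cong) auto
      moreover have "count m x = 1"
        using m True by (meson count_greater_eq_one_iff le_antisym line_words_iff)
      ultimately show ?thesis using A_\<tau>[of x] c by simp
    next
      case False
      then have "filter_mset (\<lambda>y. x \<in># w y) \<tau> = {#}" using inside by auto
      with c False show ?thesis by (simp add: not_in_iff)
    qed
  qed
  with m show ?thesis by simp
qed

end


section \<open>The semiring of contexts\<close>

context affine_plane
begin

text \<open>The class of \<open>u\<close> in the syntactic congruence of the set of line words is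
  represented by its set of contexts.\<close>

definition contexts :: "'a multiset \<Rightarrow> 'a multiset set" where
  "contexts u = {c. u + c \<in> line_words}"

text \<open>
  Sets of contexts with a common element are equal, so \<open>\<inter>\<close> is the addition of a flat semiring with
  zero \<open>{}\<close>.
\<close>

definition context_ai :: "'a multiset set ai_alg" where
  "context_ai = \<lparr>carrier = range contexts, add = (\<inter>),
    mult = (\<lambda>X Y. {c. \<exists>u. contexts u = X \<and> u + c \<in> Y})\<rparr>"

text \<open>Of the at least three points of \<open>u + c\<close>, two lie in \<open>c\<close> or two
  lie in \<open>u\<close>. Two points determine the line, so \<open>u = v\<close> in the first case
  and \<open>c = d\<close> in the second.\<close>

lemma contexts_exchange:
  assumes "u + c \<in> line_words" "v + c \<in> line_words" "u + d \<in> line_words"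
  shows "v + d \<in> line_words"
proof (cases "2 \<le> size c")
  case True
  then have "u + c = v + c" using assms line_word_unique[of "u + c" "v + c" c] by simp
  then show ?thesis using assms by simp
next
  case False
  then have "2 \<le> size u" using size_line_word[OF assms(1)] order by simp
  then have "u + c = u + d" using assms line_word_unique[of "u + c" "u + d" u] by simp
  then show ?thesis using assms by simp
qed

lemma contexts_meet:
  assumes "c \<in> contexts u" "c \<in> contexts v"
  shows "contexts u = contexts v"
proof (rule set_eqI)
  show "d \<in> contexts u \<longleftrightarrow> d \<in> contexts v" for d
    using assms contexts_exchange[of u c v d] contexts_exchange[of v c u d]
    by (auto simp: contexts_def)
qed

text \<open>A word longer than \<open>p\<close> cannot be completed to a line.\<close>

lemma empty_in_range_contexts: "{} \<in> range contexts"
proof (rule range_eqI)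
  have "replicate_mset (Suc p) x + c \<notin> line_words" for x c
  proof
    assume "replicate_mset (Suc p) x + c \<in> line_words"
    then have "size (replicate_mset (Suc p) x + c) = p" by (rule size_line_word)
    then show False by simp
  qed
  then show "{} = contexts (replicate_mset (Suc p) undefined)"
    unfolding contexts_def by (simp del: replicate_mset_Suc)
qed

lemma Int_in_range_contexts:
  assumes "X \<in> range contexts" "Y \<in> range contexts"
  shows "X \<inter> Y \<in> range contexts"
proof (cases "X \<inter> Y = {}")
  case True
  then show ?thesis using empty_in_range_contexts by simp
next
  case False
  then have "X = Y" using assms contexts_meet by blast
  then show ?thesis using assms by simp
qed

text \<open>The choice of the representative is immaterial: for \<open>Y = contexts v\<close> the
  condition says that \<open>v + c\<close> is a context of it, which depends on its class
  only.\<close>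

lemma context_ai_mult: "contexts u \<otimes>\<^bsub>context_ai\<^esub> Y = {c. u + c \<in> Y}" if Y: "Y \<in> range contexts"
proof -
  obtain v where v: "Y = contexts v" using Y by blast
  have "u' + c \<in> Y \<longleftrightarrow> v + c \<in> contexts u'" for c u'
    by (simp add: v contexts_def ac_simps)
  then show ?thesis unfolding context_ai_def by auto
qed

lemma context_ai_mult_contexts: "contexts u \<otimes>\<^bsub>context_ai\<^esub> contexts v = contexts (u + v)"
  by (subst context_ai_mult) (auto simp: contexts_def ac_simps)

lemma carrier_context_ai: "carrier context_ai = range contexts"
  by (simp add: context_ai_def)

lemma add_context_ai: "X \<oplus>\<^bsub>context_ai\<^esub> Y = X \<inter> Y"
  by (simp add: context_ai_def)

lemma finite_context_ai: "finite (carrier context_ai)"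
proof -
  let ?F = "mset_set ` Pow P"
  have "contexts u \<subseteq> ?F" for u
  proof
    fix c assume "c \<in> contexts u"
    then have m: "u + c \<in> line_words" by (simp add: contexts_def)
    have "count c x \<le> 1" for x
      by (rule subset_line_word_count[OF m]) simp
    then have "c = mset_set (set_mset c)" by (simp add: mset_set_set_mset)
    moreover have "set_mset c \<subseteq> P" using m line_subset by (auto simp: line_words_iff)
    ultimately show "c \<in> ?F" by blast
  qed
  then have "carrier context_ai \<subseteq> Pow ?F" by (auto simp: context_ai_def)
  then show ?thesis using finite_points by (meson finite_Pow_iff finite_imageI finite_subset)
qed

lemma ai_semiring_context_ai: "ai_semiring context_ai"
proof (unfold_locales, goal_cases)
  \<comment> \<open>Multiplication by a class is a preimage under adding a word, and preimages
    commute with intersections.\<close>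
  case (8 X Y Z)
  then obtain u where u: "X = contexts u" by (auto simp: carrier_context_ai)
  show ?case
    using 8 unfolding u add_context_ai carrier_context_ai
    by (subst (1 2 3) context_ai_mult) (auto intro: Int_in_range_contexts)
next
  case (9 X Y Z)
  have comm: "A \<otimes>\<^bsub>context_ai\<^esub> B = B \<otimes>\<^bsub>context_ai\<^esub> A" if "A \<in> range contexts" "B \<in> range contexts" for A B
    using that by (auto simp: context_ai_mult_contexts add.commute)
  obtain u where u: "Z = contexts u" using 9 by (auto simp: carrier_context_ai)
  have "(X \<inter> Y) \<otimes>\<^bsub>context_ai\<^esub> Z = Z \<otimes>\<^bsub>context_ai\<^esub> (X \<inter> Y)"
    "X \<otimes>\<^bsub>context_ai\<^esub> Z = Z \<otimes>\<^bsub>context_ai\<^esub> X" "Y \<otimes>\<^bsub>context_ai\<^esub> Z = Z \<otimes>\<^bsub>context_ai\<^esub> Y"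
    using 9 by (auto simp: carrier_context_ai intro!: comm Int_in_range_contexts)
  then show ?case
    using 9 unfolding u add_context_ai carrier_context_ai
    by (simp add: context_ai_mult Int_in_range_contexts Collect_conj_eq)
qed (auto simp: carrier_context_ai add_context_ai context_ai_mult_contexts add.assoc
    Int_in_range_contexts)

text \<open>Addition is intersection, so a context must complete all words of the term at once;
  multiplication moves a factor into the context.\<close>

lemma eval_context_ai:
  "ai_eval context_ai (\<lambda>n. contexts (w n)) t = {c. \<forall>u\<in>term_words t. subst_word w u + c \<in> line_words}"
proof (induction t)
  case (Mult s t)
  let ?e = "ai_eval context_ai (\<lambda>n. contexts (w n))"
  have "?e r \<in> range contexts" for r
    using eval_closed[OF ai_semiring_context_ai, of "\<lambda>n. contexts (w n)" r] by (simp add: carrier_context_ai)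
  then obtain u where u: "?e s = contexts u" and t: "?e t \<in> range contexts" by blast
  have "?e (Mult s t) = {c. u + c \<in> ?e t}" using u t by (simp add: context_ai_mult)
  also have "\<dots> = {c. \<forall>\<tau>\<in>term_words t. subst_word w \<tau> + c \<in> ?e s}"
    unfolding Mult.IH(2) unfolding u by (simp add: contexts_def ac_simps)
  also have "\<dots> = {c. \<forall>u\<in>term_words (Mult s t). subst_word w u + c \<in> line_words}"
  proof -
    have "(\<forall>u\<in>term_words (Mult s t). Q u) \<longleftrightarrow> (\<forall>\<tau>\<in>term_words t. \<forall>\<sigma>\<in>term_words s. Q (\<sigma> + \<tau>))" for Q
      by auto
    then show ?thesis unfolding Mult.IH(1) by (simp add: add.assoc)
  qed
  finally show ?case .
qed (auto simp: contexts_def add_context_ai)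

text \<open>The transfer of lines gives one inclusion between the values, and symmetry the other.
  The fresh variable for the context accounts for \<open>Suc\<close> in the bound.\<close>

lemma context_ai_satisfies:
  assumes sat: "satisfies (power_ai :: s7 set ai_alg) (s, t)"
    and few: "Suc (card (term_vars s \<union> term_vars t)) < p"
  shows "satisfies context_ai (s, t)"
proof -
  have sub: "ai_eval context_ai v s \<subseteq> ai_eval context_ai v t"
    if v: "\<And>n. v n \<in> carrier context_ai" and sat: "satisfies (power_ai :: s7 set ai_alg) (s, t)"
      and few: "Suc (card (term_vars s \<union> term_vars t)) < p" for v s t
  proof
    fix c assume c: "c \<in> ai_eval context_ai v s"
    obtain w where w: "v = (\<lambda>n. contexts (w n))"
      using v unfolding carrier_context_ai image_iff by metis
    obtain z where z: "z \<notin> term_vars s \<union> term_vars t"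
      using ex_new_if_finite[of "term_vars s \<union> term_vars t"] finite_term_vars by auto
    \<comment> \<open>The context \<open>c\<close> becomes the value of a fresh factor \<open>z\<close> of both sides.\<close>
    define w' where "w' = w(z := c)"
    have w': "subst_word w' u = subst_word w u" if "set_mset u \<subseteq> term_vars s \<union> term_vars t" for u
      using that z by (intro arg_cong[of _ _ sum_mset] image_mset_cong) (auto simp: w'_def)
    have words: "subst_word w' (add_mset z u) = subst_word w u + c"
      if "u \<in> term_words s \<union> term_words t" for u
      using that term_words_vars[of u] w'[of u] by (auto simp: w'_def)
    have mult: "term_words (Mult r (Var z)) = add_mset z ` term_words r" for r
      by auto
    have "satisfies (power_ai :: s7 set ai_alg) (Mult s (Var z), Mult t (Var z))"
      using sat by (simp add: satisfies_def)
    moreover have "card (term_vars (Mult s (Var z)) \<union> term_vars (Mult t (Var z))) < p"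
      using few z by (simp add: finite_term_vars Un_ac)
    moreover have "subst_word w' \<sigma> \<in> line_words" if "\<sigma> \<in> term_words (Mult s (Var z))" for \<sigma>
      using that c words unfolding w eval_context_ai mult by auto
    ultimately have "subst_word w' (add_mset z u) \<in> line_words" if "u \<in> term_words t" for u
      by (rule line_words_transfer) (use that in auto)
    then show "c \<in> ai_eval context_ai v t"
      unfolding w eval_context_ai using words by auto
  qed
  have sat': "satisfies (power_ai :: s7 set ai_alg) (t, s)"
    using sat by (auto simp: satisfies_def)
  then show ?thesis
    unfolding satisfies_def fst_conv snd_conv
    by (intro allI impI equalityI sub) (use sat sat' few in \<open>simp_all add: Un_commute\<close>)
qed

end

section \<open>The identity of an affine plane\<close>

text \<open>The product over the plane is decided by at most two points: a zero, two values
  \<open>S7_a\<close>, or a point outside which all values are 1. A line through them has the same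
  product.\<close>

lemma prod_s7_plane:
  fixes \<alpha> :: "nat \<Rightarrow> s7"
  assumes "affine_plane P L p"
  obtains l where "l \<in> L" "prod \<alpha> l = prod \<alpha> P"
proof -
  interpret affine_plane P L p by fact
  have prod0: "prod \<alpha> A = 0" if "finite A" "x \<in> A" "\<alpha> x = 0" for A x
    using that by (simp add: prod.remove)
  have proda: "prod \<alpha> A = 0" if "finite A" "{x, y} \<subseteq> A" "x \<noteq> y" "\<alpha> x = S7_a" "\<alpha> y = S7_a" for A x y
  proof -
    have "prod \<alpha> A = \<alpha> x * (\<alpha> y * prod \<alpha> (A - {x} - {y}))"
      using that by (simp add: prod.remove[of A x] prod.remove[of "A - {x}" y])
    also have "\<dots> = (S7_a * S7_a) * prod \<alpha> (A - {x} - {y})"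
      by (simp only: that mult.assoc)
    also have "\<dots> = 0" by (simp add: zero_s7_def[symmetric])
    finally show ?thesis .
  qed
  have prod1: "prod \<alpha> A = \<alpha> x" if "finite A" "x \<in> A" "\<And>y. y \<in> A \<Longrightarrow> y \<noteq> x \<Longrightarrow> \<alpha> y = 1" for A x
    using that by (simp add: prod.remove)
  have "P \<noteq> {}" using card_points order by auto
  then obtain x0 where x0: "x0 \<in> P" by blast
  have cases: "\<alpha> y = 0 \<or> \<alpha> y = S7_a \<or> \<alpha> y = 1" for y
    by (cases "\<alpha> y") (auto simp: zero_s7_def one_s7_def)
  obtain x where x: "x \<in> P" and
    alt: "\<alpha> x = 0 \<or> (\<exists>y\<in>P. x \<noteq> y \<and> \<alpha> x = S7_a \<and> \<alpha> y = S7_a) \<or> (\<forall>y\<in>P. y \<noteq> x \<longrightarrow> \<alpha> y = 1)"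
    using x0 cases by metis
  from alt obtain y where y: "y \<in> P" and
    alt: "\<alpha> x = 0 \<or> (x \<noteq> y \<and> \<alpha> x = S7_a \<and> \<alpha> y = S7_a) \<or> (\<forall>y\<in>P. y \<noteq> x \<longrightarrow> \<alpha> y = 1)"
    using x by blast
  obtain l where l: "l \<in> L" "x \<in> l" "y \<in> l" using line_through x y by blast
  have "prod \<alpha> l = prod \<alpha> P"
    using alt
  proof (elim disjE conjE)
    assume "\<alpha> x = 0"
    then show ?thesis using prod0 l x finite_line finite_points by simp
  next
    assume "x \<noteq> y" "\<alpha> x = S7_a" "\<alpha> y = S7_a"
    then show ?thesis using proda[of _ x y] l x y finite_line finite_points by simp
  next
    assume "\<forall>y\<in>P. y \<noteq> x \<longrightarrow> \<alpha> y = 1"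
    then show ?thesis using prod1[of _ x] l x line_subset finite_line finite_points by (simp add: subset_iff)
  qed
  with l that show ?thesis by blast
qed

lemma plane_identity:
  fixes P :: "nat set"
  assumes plane: "affine_plane P L p"
    and s: "term_words s = affine_plane.line_words L"
    and t: "term_words t = insert (mset_set P) (affine_plane.line_words L)"
  shows "satisfies (power_ai :: s7 set ai_alg) (s, t)"
    and "\<not> satisfies (affine_plane.context_ai L) (s, t)"
proof -
  interpret affine_plane P L p by fact
  show "satisfies (power_ai :: s7 set ai_alg) (s, t)"
    unfolding satisfies_def fst_conv snd_conv
  proof (intro allI impI equalityI subsetI)
    fix v :: "nat \<Rightarrow> s7 set" and z
    assume v: "\<forall>n. v n \<in> carrier power_ai"
    then have ne: "v n \<noteq> {}" for n by (simp add: power_ai_def)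
    {
      assume "z \<in> ai_eval power_ai v s"
      then obtain u where u: "u \<in> term_words s" "(\<forall>x. count u x \<le> 1) \<longrightarrow>
          (\<exists>\<alpha>. (\<forall>n. \<alpha> n \<in> v n) \<and> z = (\<Prod>y\<in>#u. \<alpha> y))"
        using eval_power_linear[of v] ne by blast
      then obtain \<alpha> where "\<And>n. \<alpha> n \<in> v n" "z = (\<Prod>y\<in>#u. \<alpha> y)"
        by (auto simp: s line_words_iff)
      then show "z \<in> ai_eval power_ai v t"
        using eval_power_choice[of \<alpha> v u t] u by (simp add: s t)
    }
    assume "z \<in> ai_eval power_ai v t"
    then obtain u where u: "u \<in> term_words t" "(\<forall>x. count u x \<le> 1) \<longrightarrow>
        (\<exists>\<alpha>. (\<forall>n. \<alpha> n \<in> v n) \<and> z = (\<Prod>y\<in>#u. \<alpha> y))"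
      using eval_power_linear[of v] ne by blast
    moreover have "\<forall>x. count u x \<le> 1"
      using u(1) by (auto simp: t line_words_iff count_mset_set')
    ultimately obtain \<alpha> where \<alpha>: "\<And>n. \<alpha> n \<in> v n" "z = (\<Prod>y\<in>#u. \<alpha> y)" by blast
    \<comment> \<open>A value of the word of the whole plane is, for the same
      \<open>\<alpha>\<close>, the value of some line.\<close>
    obtain m where "m \<in> line_words" "z = (\<Prod>y\<in>#m. \<alpha> y)"
    proof (cases "u \<in> line_words")
      case False
      then have "z = prod \<alpha> P" using u(1) \<alpha>(2) by (simp add: t prod_unfold_prod_mset)
      then show ?thesis
        using prod_s7_plane[OF plane, of \<alpha>] that by (metis imageI line_words_def prod_unfold_prod_mset)
    qed (use \<alpha> in blast)
    then show "z \<in> ai_eval power_ai v s"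
      using eval_power_choice[of \<alpha> v m s] \<alpha>(1) by (simp add: s)
  qed
  have "p < card P" using card_points order by simp
  then have "mset_set P \<notin> line_words" using size_line_word by fastforce
  \<comment> \<open>Every point is sent to its own class. The empty context then tests whether all
    words are lines, which fails for the word of the plane.\<close>
  moreover have "{#} \<in> ai_eval context_ai (\<lambda>n. contexts {#n#}) s"
    by (simp add: eval_context_ai s)
  moreover have "{#} \<notin> ai_eval context_ai (\<lambda>n. contexts {#n#}) t" if "mset_set P \<notin> line_words"
    using that by (simp add: eval_context_ai t)
  ultimately have "ai_eval context_ai (\<lambda>n. contexts {#n#}) s \<noteq> ai_eval context_ai (\<lambda>n. contexts {#n#}) t"
    by blast
  then show "\<not> satisfies context_ai (s, t)"
    unfolding satisfies_def by (force simp: carrier_context_ai)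
qed

theorem theorem4p8:
  assumes "infinite (UNIV :: 'b set)"
  shows "\<not> finitely_based TYPE('b) (power_ai :: s7 set ai_alg)"
proof
  let ?S = "power_ai :: s7 set ai_alg"
  assume "finitely_based TYPE('b) ?S"
  then obtain E where E: "finite E" "defines_variety TYPE('b) E ?S"
    unfolding finitely_based_def by blast
  define vars where "vars e = term_vars (fst e) \<union> term_vars (snd e)" for e
  obtain N where N: "card (vars e) \<le> N" if "e \<in> E" for e
    using finite_imageI[OF E(1), of "\<lambda>e. card (vars e)"] by (auto simp: finite_nat_set_iff_bounded_le)
  \<comment> \<open>The margin covers both the extra variable for the context and the order bound of
    the plane.\<close>
  obtain p :: nat where p: "prime p" "N + 2 < p" using bigger_prime by blast
  then obtain P0 :: "(int \<times> int) set" and L0 where "affine_plane P0 L0 p"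
    using affine_plane_exists[of p] by auto
  then have plane: "affine_plane (to_nat ` P0) ((`) to_nat ` L0) p"
    by (rule affine_plane_image) simp
  then interpret affine_plane "to_nat ` P0" "(`) to_nat ` L0" p .
  have fin7: "finite (carrier ?S)"
  proof -
    have "(UNIV :: s7 set) = {S7_zero, S7_a, S7_one}" using s7.exhaust by blast
    then have "finite (UNIV :: s7 set)" by (metis finite.simps)
    then show ?thesis by (simp add: power_ai_def Finite_Set.finite_set rev_finite_subset[of "UNIV :: s7 set set"])
  qed
  \<comment> \<open>A copy of the power semiring inside \<open>'b\<close> belongs to its variety, so
    \<open>E\<close> consists of identities of it.\<close>
  have E7: "satisfies ?S e" if "e \<in> E" for e
  proof -
    obtain T :: "'b ai_alg" where "ai_semiring T" "T \<in> variety ?S" and T: "\<And>e. satisfies T e \<longleftrightarrow> satisfies ?S e"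
      by (rule infinite_type_copy[OF ai_semiring_power_ai fin7 assms]) (rule that)
    then have "T \<in> ai_models E" using E by (simp add: defines_variety_def)
    then show ?thesis using T that by (simp add: ai_models_def)
  qed
  obtain T :: "'b ai_alg" where "ai_semiring T" "T \<in> variety context_ai" and T: "\<And>e. satisfies T e \<longleftrightarrow> satisfies context_ai e"
    by (rule infinite_type_copy[OF ai_semiring_context_ai finite_context_ai assms]) (rule that)
  moreover have "satisfies context_ai e" if "e \<in> E" for e
    using context_ai_satisfies[of "fst e" "snd e"] E7[OF that] N[OF that] p by (simp add: vars_def)
  ultimately have "T \<in> ai_models E" by (simp add: ai_models_def)
  then have "T \<in> variety ?S" using E by (simp add: defines_variety_def)
  \<comment> \<open>The constant assignment serves merely to produce some line.\<close>
  obtain l where "l \<in> (`) to_nat ` L0"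
    by (rule prod_s7_plane[OF plane, of "\<lambda>_. 1"]) (rule that)
  then have ne: "line_words \<noteq> {}" by (auto simp: line_words_def)
  have "{#} \<notin> line_words" using size_line_word order by fastforce
  moreover have "mset_set (to_nat ` P0) \<noteq> {#}"
    using card_points order finite_points by (metis card.empty mset_set_empty_iff mult_is_0 not_numeral_le_zero)
  ultimately obtain s t where st: "term_words s = line_words"
    "term_words t = insert (mset_set (to_nat ` P0)) line_words"
    using term_of_words[of line_words] term_of_words[of "insert (mset_set (to_nat ` P0)) line_words"]
      ne finite_line_words by auto
  have "satisfies T (s, t)"
    by (rule variety_satisfies[OF \<open>T \<in> variety ?S\<close>]) (rule plane_identity(1)[OF plane st])
  then show False using T plane_identity(2)[OF plane st] by simp
qed

end
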